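(* Let $X$ be a separable compact topological space and let $A=C(X)$ be the $C^{*}$-algebra of continuous complex valued functions on $X$. Then $ZDRR(A)=0$.
   Context: An element $x$ of a $C^{*}$-algebra $A$ is a zero divisor if there is a nonzero $y\in A$ with $xy=0$ or $yx=0$ (so $0$ is a zero divisor in a nonzero algebra). The zero divisor real rank $ZDRR(A)$: for an integer $n\ge 0$, say $ZDRR(A)\le n$ if every $(n+1)$-tuple of self adjoint elements $(a_1,\ldots,a_{n+1})$ of $A$ can be approximated arbitrarily closely in norm by an $(n+1)$-tuple of self adjoint elements $(b_1,\ldots,b_{n+1})$ such that $\sum_{i=1}^{n+1} b_i^{2}$ is not a zero divisor. $ZDRR(A)=n$ if $n$ is the least nonnegative integer with $ZDRR(A)\le n$. A space is separable if it has a countable dense subset. *)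

theory Defs
  imports "HOL-Analysis.Analysis" "HOL-Algebra.Module"
begin

section \<open>C*-algebras\<close>

record 'a star_algebra = "(complex, 'a) module" +
  adj :: "'a \<Rightarrow> 'a"
  alg_norm :: "'a \<Rightarrow> real"

text \<open>
  C*-algebras need not be unital, so the field \<open>one\<close> inherited from the ring record
  is left unconstrained here.
\<close>

locale cstar_algebra = abelian_group A for A :: "('a, 'm) star_algebra_scheme" (structure) +
  assumes mult_closed: "x \<in> carrier A \<Longrightarrow> y \<in> carrier A \<Longrightarrow> x \<otimes> y \<in> carrier A"
    and mult_assoc: "x \<in> carrier A \<Longrightarrow> y \<in> carrier A \<Longrightarrow> z \<in> carrier A \<Longrightarrow>
      (x \<otimes> y) \<otimes> z = x \<otimes> (y \<otimes> z)"
    and mult_l_distr: "x \<in> carrier A \<Longrightarrow> y \<in> carrier A \<Longrightarrow> z \<in> carrier A \<Longrightarrow>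
      (x \<oplus> y) \<otimes> z = x \<otimes> z \<oplus> y \<otimes> z"
    and mult_r_distr: "x \<in> carrier A \<Longrightarrow> y \<in> carrier A \<Longrightarrow> z \<in> carrier A \<Longrightarrow>
      z \<otimes> (x \<oplus> y) = z \<otimes> x \<oplus> z \<otimes> y"
    and smult_closed: "x \<in> carrier A \<Longrightarrow> c \<odot> x \<in> carrier A"
    and smult_l_distr: "x \<in> carrier A \<Longrightarrow> (c + d) \<odot> x = c \<odot> x \<oplus> d \<odot> x"
    and smult_r_distr: "x \<in> carrier A \<Longrightarrow> y \<in> carrier A \<Longrightarrow> c \<odot> (x \<oplus> y) = c \<odot> x \<oplus> c \<odot> y"
    and smult_assoc: "x \<in> carrier A \<Longrightarrow> (c * d) \<odot> x = c \<odot> (d \<odot> x)"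
    and smult_one: "x \<in> carrier A \<Longrightarrow> 1 \<odot> x = x"
    and smult_mult_l: "x \<in> carrier A \<Longrightarrow> y \<in> carrier A \<Longrightarrow> (c \<odot> x) \<otimes> y = c \<odot> (x \<otimes> y)"
    and smult_mult_r: "x \<in> carrier A \<Longrightarrow> y \<in> carrier A \<Longrightarrow> x \<otimes> (c \<odot> y) = c \<odot> (x \<otimes> y)"
    and adj_closed: "x \<in> carrier A \<Longrightarrow> adj A x \<in> carrier A"
    and adj_adj: "x \<in> carrier A \<Longrightarrow> adj A (adj A x) = x"
    and adj_add: "x \<in> carrier A \<Longrightarrow> y \<in> carrier A \<Longrightarrow> adj A (x \<oplus> y) = adj A x \<oplus> adj A y"
    and adj_smult: "x \<in> carrier A \<Longrightarrow> adj A (c \<odot> x) = cnj c \<odot> adj A x"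
    and adj_mult: "x \<in> carrier A \<Longrightarrow> y \<in> carrier A \<Longrightarrow> adj A (x \<otimes> y) = adj A y \<otimes> adj A x"
    and norm_eq_zero: "x \<in> carrier A \<Longrightarrow> alg_norm A x = 0 \<longleftrightarrow> x = \<zero>"
    and norm_triangle: "x \<in> carrier A \<Longrightarrow> y \<in> carrier A \<Longrightarrow>
      alg_norm A (x \<oplus> y) \<le> alg_norm A x + alg_norm A y"
    and norm_smult: "x \<in> carrier A \<Longrightarrow> alg_norm A (c \<odot> x) = cmod c * alg_norm A x"
    and norm_mult: "x \<in> carrier A \<Longrightarrow> y \<in> carrier A \<Longrightarrow>
      alg_norm A (x \<otimes> y) \<le> alg_norm A x * alg_norm A y"
    and cstar_identity: "x \<in> carrier A \<Longrightarrow> alg_norm A (adj A x \<otimes> x) = (alg_norm A x)\<^sup>2"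
    and complete: "range s \<subseteq> carrier A \<Longrightarrow>
      (\<And>e. e > 0 \<Longrightarrow> \<exists>N. \<forall>m\<ge>N. \<forall>n\<ge>N. alg_norm A (s m \<ominus> s n) < e) \<Longrightarrow>
      \<exists>l \<in> carrier A. (\<lambda>n. alg_norm A (s n \<ominus> l)) \<longlonglongrightarrow> 0"


section \<open>Zero divisor real rank\<close>

definition self_adjoint :: "('a, 'm) star_algebra_scheme \<Rightarrow> 'a \<Rightarrow> bool" where
  "self_adjoint A x \<longleftrightarrow> x \<in> carrier A \<and> adj A x = x"

definition zero_divisor :: "('a, 'm) ring_scheme \<Rightarrow> 'a \<Rightarrow> bool" where
  "zero_divisor A x \<longleftrightarrow> x \<in> carrier A \<and>
     (\<exists>y \<in> carrier A. y \<noteq> \<zero>\<^bsub>A\<^esub> \<and> (x \<otimes>\<^bsub>A\<^esub> y = \<zero>\<^bsub>A\<^esub> \<or> y \<otimes>\<^bsub>A\<^esub> x = \<zero>\<^bsub>A\<^esub>))"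

definition ZDRR_le :: "('a, 'm) star_algebra_scheme \<Rightarrow> nat \<Rightarrow> bool" where
  "ZDRR_le A n \<longleftrightarrow>
     (\<forall>a. (\<forall>i \<in> {1..n+1}. self_adjoint A (a i)) \<longrightarrow>
       (\<forall>\<epsilon>>0. \<exists>b. (\<forall>i \<in> {1..n+1}. self_adjoint A (b i) \<and> alg_norm A (a i \<ominus>\<^bsub>A\<^esub> b i) < \<epsilon>) \<and>
         \<not> zero_divisor A (\<Oplus>\<^bsub>A\<^esub>i \<in> {1..n+1}. b i \<otimes>\<^bsub>A\<^esub> b i)))"

text \<open>The value is \<open>\<infinity>\<close> if no bound holds.\<close>

definition ZDRR :: "('a, 'm) star_algebra_scheme \<Rightarrow> enat" where
  "ZDRR A = (INF n \<in> {n. ZDRR_le A n}. enat n)"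


section \<open>The algebra of continuous functions on a compact space\<close>

text \<open>
  Functions are made \<open>undefined\<close> outside \<open>topspace X\<close>, so that equality in the algebra is
  equality on the space. Inserting \<open>0\<close> does not change the supremum unless the space is empty,
  in which case it makes the norm of the only function \<open>0\<close>.
\<close>

definition cfun_algebra :: "'x topology \<Rightarrow> ('x \<Rightarrow> complex) star_algebra" where
  "cfun_algebra X =
    \<lparr> carrier = {f \<in> extensional (topspace X). continuous_map X euclidean f},
      mult = (\<lambda>f g. \<lambda>x \<in> topspace X. f x * g x),
      one = (\<lambda>x \<in> topspace X. 1),
      zero = (\<lambda>x \<in> topspace X. 0),
      add = (\<lambda>f g. \<lambda>x \<in> topspace X. f x + g x),
      smult = (\<lambda>c f. \<lambda>x \<in> topspace X. c * f x),
      adj = (\<lambda>f. \<lambda>x \<in> topspace X. cnj (f x)),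
      alg_norm = (\<lambda>f. Sup (insert 0 ((\<lambda>x. cmod (f x)) ` topspace X))) \<rparr>"

lemma cfun_algebra_simps [simp]:
  "carrier (cfun_algebra X) = {f \<in> extensional (topspace X). continuous_map X euclidean f}"
  "mult (cfun_algebra X) f g = (\<lambda>x \<in> topspace X. f x * g x)"
  "one (cfun_algebra X) = (\<lambda>x \<in> topspace X. 1)"
  "zero (cfun_algebra X) = (\<lambda>x \<in> topspace X. 0)"
  "add (cfun_algebra X) f g = (\<lambda>x \<in> topspace X. f x + g x)"
  "smult (cfun_algebra X) c f = (\<lambda>x \<in> topspace X. c * f x)"
  "adj (cfun_algebra X) f = (\<lambda>x \<in> topspace X. cnj (f x))"
  by (simp_all add: cfun_algebra_def)

lemma continuous_map_restrict_topspace: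
  "continuous_map X Y (restrict f (topspace X)) \<longleftrightarrow> continuous_map X Y f"
  by (rule iffI; erule continuous_map_eq) auto

lemma continuous_map_complex_mult:
  fixes f g :: "'x \<Rightarrow> complex"
  assumes "continuous_map X euclidean f" "continuous_map X euclidean g"
  shows "continuous_map X euclidean (\<lambda>x. f x * g x)"
  using assms by (simp add: continuous_map_atin tendsto_mult)

lemma continuous_map_cnj:
  assumes "continuous_map X euclidean f"
  shows "continuous_map X euclidean (\<lambda>x. cnj (f x))"
proof -
  have "continuous_map euclidean euclidean cnj"
    by (simp add: continuous_on_cnj)
  from continuous_map_compose[OF assms this] show ?thesis
    by (simp add: o_def)
qed

lemma abelian_group_cfun_algebra: "abelian_group (cfun_algebra X)"
proof (rule abelian_groupI)
  fix f assume f: "f \<in> carrier (cfun_algebra X)"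
  then have "continuous_map X euclidean (\<lambda>x. - f x)"
    by (auto intro: continuous_map_minus)
  with f show "\<exists>g \<in> carrier (cfun_algebra X). g \<oplus>\<^bsub>cfun_algebra X\<^esub> f = \<zero>\<^bsub>cfun_algebra X\<^esub>"
    by (intro bexI[of _ "\<lambda>x \<in> topspace X. - f x"])
       (auto simp: continuous_map_restrict_topspace cong: restrict_cong)
next
  fix f g assume "f \<in> carrier (cfun_algebra X)" "g \<in> carrier (cfun_algebra X)"
  then show "f \<oplus>\<^bsub>cfun_algebra X\<^esub> g \<in> carrier (cfun_algebra X)"
    by (auto simp: continuous_map_restrict_topspace intro!: continuous_map_add)
next
  show "\<zero>\<^bsub>cfun_algebra X\<^esub> \<in> carrier (cfun_algebra X)"
    by (simp add: continuous_map_restrict_topspace)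
qed (auto simp: fun_eq_iff restrict_def algebra_simps extensional_def)

lemma cfun_algebra_minus:
  assumes "f \<in> carrier (cfun_algebra X)" "g \<in> carrier (cfun_algebra X)"
  shows "f \<ominus>\<^bsub>cfun_algebra X\<^esub> g = (\<lambda>x \<in> topspace X. f x - g x)"
proof -
  interpret abelian_group "cfun_algebra X"
    by (rule abelian_group_cfun_algebra)
  have "(\<lambda>x \<in> topspace X. - g x) \<in> carrier (cfun_algebra X)"
    using assms by (auto simp: continuous_map_restrict_topspace intro!: continuous_map_minus)
  moreover have "(\<lambda>x \<in> topspace X. - g x) \<oplus>\<^bsub>cfun_algebra X\<^esub> g = \<zero>\<^bsub>cfun_algebra X\<^esub>"
    by (auto simp: restrict_def)
  ultimately have "\<ominus>\<^bsub>cfun_algebra X\<^esub> g = (\<lambda>x \<in> topspace X. - g x)"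
    using assms(2) minus_equality by blast
  then show ?thesis
    by (auto simp: a_minus_def restrict_def)
qed

lemma cfun_norm_bdd_above:
  assumes "compact_space X" "f \<in> carrier (cfun_algebra X)"
  shows "bdd_above (insert 0 ((\<lambda>x. cmod (f x)) ` topspace X))"
proof -
  have "compactin euclidean (f ` topspace X)"
    using assms image_compactin[of X "topspace X" euclidean f] by (auto simp: compact_space_def)
  then obtain B where "\<forall>z \<in> f ` topspace X. cmod z \<le> B"
    using bounded_iff compact_imp_bounded by (metis compactin_euclidean_iff)
  then show ?thesis
    by (auto intro!: bdd_aboveI[of _ B])
qed

lemma cfun_norm_le_iff:
  assumes "compact_space X" "f \<in> carrier (cfun_algebra X)"
  shows "alg_norm (cfun_algebra X) f \<le> r \<longleftrightarrow> 0 \<le> r \<and> (\<forall>x \<in> topspace X. cmod (f x) \<le> r)"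
proof -
  have "Sup (insert 0 ((\<lambda>x. cmod (f x)) ` topspace X)) \<le> r \<longleftrightarrow>
      (\<forall>t \<in> insert 0 ((\<lambda>x. cmod (f x)) ` topspace X). t \<le> r)"
    by (rule cSup_le_iff) (use cfun_norm_bdd_above[OF assms] in auto)
  then show ?thesis
    by (simp add: cfun_algebra_def)
qed

lemma cfun_norm_ge:
  assumes "compact_space X" "f \<in> carrier (cfun_algebra X)"
  shows "0 \<le> alg_norm (cfun_algebra X) f"
    and "x \<in> topspace X \<Longrightarrow> cmod (f x) \<le> alg_norm (cfun_algebra X) f"
  using cfun_norm_le_iff[OF assms, of "alg_norm (cfun_algebra X) f"] by auto

theorem cstar_algebra_cfun_algebra:
  fixes X :: "'x topology"
  assumes X: "compact_space X"
  shows "cstar_algebra (cfun_algebra X)"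
proof -
  let ?A = "cfun_algebra X"
  interpret abelian_group ?A
    by (rule abelian_group_cfun_algebra)
  note cr = continuous_map_restrict_topspace
  have mult: "f \<otimes>\<^bsub>?A\<^esub> g \<in> carrier ?A" if "f \<in> carrier ?A" "g \<in> carrier ?A" for f g
    using that by (auto simp: cr intro!: continuous_map_complex_mult)
  have sm: "c \<odot>\<^bsub>?A\<^esub> f \<in> carrier ?A" if "f \<in> carrier ?A" for c f
    using that by (auto simp: cr intro!: continuous_map_complex_mult)
  have adj: "adj ?A f \<in> carrier ?A" if "f \<in> carrier ?A" for f
    using that by (auto simp: cr intro!: continuous_map_cnj)
  have norm_le: "alg_norm ?A f \<le> r"
    if "f \<in> carrier ?A" "0 \<le> r" "\<And>x. x \<in> topspace X \<Longrightarrow> cmod (f x) \<le> r" for f r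
    using cfun_norm_le_iff[OF X that(1)] that by blast
  have norm_ge: "0 \<le> alg_norm ?A f" "x \<in> topspace X \<Longrightarrow> cmod (f x) \<le> alg_norm ?A f"
    if "f \<in> carrier ?A" for f x
    using cfun_norm_ge[OF X that] by auto
  show ?thesis
  proof (intro cstar_algebra.intro cstar_algebra_axioms.intro abelian_group_cfun_algebra)
    fix f assume f: "f \<in> carrier ?A"
    show "alg_norm ?A f = 0 \<longleftrightarrow> f = \<zero>\<^bsub>?A\<^esub>"
    proof
      assume "alg_norm ?A f = 0"
      then have "f x = 0" if "x \<in> topspace X" for x
        using norm_ge(2)[OF f that] by simp
      with f show "f = \<zero>\<^bsub>?A\<^esub>"
        by (auto simp: fun_eq_iff restrict_def extensional_def)
    next
      assume eq: "f = \<zero>\<^bsub>?A\<^esub>"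
      have "alg_norm ?A f \<le> 0"
        by (rule norm_le[OF f]) (simp_all add: eq)
      with norm_ge(1)[OF f] show "alg_norm ?A f = 0"
        by simp
    qed
  next
    fix f g assume fg: "f \<in> carrier ?A" "g \<in> carrier ?A"
    show "alg_norm ?A (f \<oplus>\<^bsub>?A\<^esub> g) \<le> alg_norm ?A f + alg_norm ?A g"
    proof (rule norm_le)
      fix x assume x: "x \<in> topspace X"
      have "cmod (f x + g x) \<le> alg_norm ?A f + alg_norm ?A g"
        using norm_triangle_ineq[of "f x" "g x"] norm_ge(2)[OF fg(1) x] norm_ge(2)[OF fg(2) x]
        by linarith
      with x show "cmod ((f \<oplus>\<^bsub>?A\<^esub> g) x) \<le> alg_norm ?A f + alg_norm ?A g"
        by simp
    qed (use fg norm_ge(1) in \<open>auto simp del: cfun_algebra_simps\<close>)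
    show "alg_norm ?A (f \<otimes>\<^bsub>?A\<^esub> g) \<le> alg_norm ?A f * alg_norm ?A g"
    proof (rule norm_le)
      fix x assume x: "x \<in> topspace X"
      have "cmod (f x * g x) \<le> alg_norm ?A f * alg_norm ?A g"
        unfolding norm_mult
        by (intro mult_mono norm_ge(2)[OF fg(1) x] norm_ge(2)[OF fg(2) x] norm_ge(1)[OF fg(1)]) simp
      with x show "cmod ((f \<otimes>\<^bsub>?A\<^esub> g) x) \<le> alg_norm ?A f * alg_norm ?A g"
        by simp
    qed (use mult[OF fg] fg norm_ge(1) in \<open>auto simp del: cfun_algebra_simps\<close>)
  next
    fix f c assume f: "f \<in> carrier ?A"
    have le: "alg_norm ?A (d \<odot>\<^bsub>?A\<^esub> g) \<le> cmod d * alg_norm ?A g" if g: "g \<in> carrier ?A" for d g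
    proof (rule norm_le)
      fix x assume x: "x \<in> topspace X"
      have "cmod (d * g x) \<le> cmod d * alg_norm ?A g"
        unfolding norm_mult by (intro mult_left_mono norm_ge(2)[OF g x]) simp
      with x show "cmod ((d \<odot>\<^bsub>?A\<^esub> g) x) \<le> cmod d * alg_norm ?A g"
        by simp
    qed (use sm[OF g] norm_ge(1)[OF g] in \<open>auto simp del: cfun_algebra_simps\<close>)
    show "alg_norm ?A (c \<odot>\<^bsub>?A\<^esub> f) = cmod c * alg_norm ?A f"
    proof (cases "c = 0")
      case True
      then show ?thesis
        using le[OF f, of c] norm_ge(1)[OF sm[OF f, of c]] by simp
    next
      case False
      have "inverse c \<odot>\<^bsub>?A\<^esub> (c \<odot>\<^bsub>?A\<^esub> f) = f"
        using f False by (auto simp: fun_eq_iff restrict_def extensional_def)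
      then have "alg_norm ?A f \<le> cmod (inverse c) * alg_norm ?A (c \<odot>\<^bsub>?A\<^esub> f)"
        using le[OF sm[OF f, of c], of "inverse c"] by simp
      then have "cmod c * alg_norm ?A f \<le> alg_norm ?A (c \<odot>\<^bsub>?A\<^esub> f)"
        using False by (simp add: norm_divide field_simps del: cfun_algebra_simps)
      with le[OF f, of c] show ?thesis
        by simp
    qed
  next
    fix f assume f: "f \<in> carrier ?A"
    let ?h = "adj ?A f \<otimes>\<^bsub>?A\<^esub> f"
    have h: "?h \<in> carrier ?A"
      by (intro mult adj f)
    have hx: "cmod (?h x) = (cmod (f x))\<^sup>2" if "x \<in> topspace X" for x
      using that by (simp add: norm_mult power2_eq_square)
    show "alg_norm ?A ?h = (alg_norm ?A f)\<^sup>2"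
    proof (rule antisym)
      show "alg_norm ?A ?h \<le> (alg_norm ?A f)\<^sup>2"
        by (rule norm_le[OF h]) (auto simp: hx intro!: power_mono norm_ge(2)[OF f] simp del: cfun_algebra_simps)
      have "alg_norm ?A f \<le> sqrt (alg_norm ?A ?h)"
      proof (rule norm_le[OF f])
        fix x assume x: "x \<in> topspace X"
        show "cmod (f x) \<le> sqrt (alg_norm ?A ?h)"
          using norm_ge(2)[OF h x] unfolding hx[OF x] by (rule real_le_rsqrt)
      qed (simp add: norm_ge(1)[OF h] del: cfun_algebra_simps)
      then show "(alg_norm ?A f)\<^sup>2 \<le> alg_norm ?A ?h"
        using norm_ge(1)[OF f] norm_ge(1)[OF h] by (metis power_mono real_sqrt_pow2)
    qed
  next
    fix s :: "nat \<Rightarrow> 'x \<Rightarrow> complex"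
    assume "range s \<subseteq> carrier ?A"
      and cauchy: "\<And>e. e > 0 \<Longrightarrow> \<exists>N. \<forall>m\<ge>N. \<forall>n\<ge>N. alg_norm ?A (s m \<ominus>\<^bsub>?A\<^esub> s n) < e"
    then have s: "s n \<in> carrier ?A" for n
      by blast
    have diff: "(s m \<ominus>\<^bsub>?A\<^esub> s n) x = s m x - s n x" if "x \<in> topspace X" for m n x
      using that cfun_algebra_minus[OF s s] by simp
    have unif: "\<exists>N. \<forall>m\<ge>N. \<forall>n\<ge>N. \<forall>x \<in> topspace X. cmod (s m x - s n x) < e" if "e > 0" for e
    proof -
      obtain N where N: "\<forall>m\<ge>N. \<forall>n\<ge>N. alg_norm ?A (s m \<ominus>\<^bsub>?A\<^esub> s n) < e"
        using cauchy \<open>e > 0\<close> by blast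
      have "cmod (s m x - s n x) < e" if "m \<ge> N" "n \<ge> N" "x \<in> topspace X" for m n x
        using N that norm_ge(2)[OF minus_closed[OF s s] that(3), of m n] diff[OF that(3), of m n]
        by (metis le_less_trans)
      then show ?thesis
        by blast
    qed
    define l where "l = (\<lambda>x \<in> topspace X. lim (\<lambda>n. s n x))"
    have lim: "(\<lambda>n. s n x) \<longlonglongrightarrow> l x" if x: "x \<in> topspace X" for x
    proof -
      have "Cauchy (\<lambda>n. s n x)"
        unfolding Cauchy_def dist_norm using unif x by meson
      then show ?thesis
        using x by (simp add: l_def convergent_LIMSEQ_iff Cauchy_convergent_iff)
    qed
    have unif_lim: "\<exists>N. \<forall>n\<ge>N. \<forall>x \<in> topspace X. cmod (s n x - l x) \<le> e" if "e > 0" for e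
    proof -
      obtain N where N: "\<forall>m\<ge>N. \<forall>n\<ge>N. \<forall>x \<in> topspace X. cmod (s m x - s n x) < e"
        using unif \<open>e > 0\<close> by blast
      have "cmod (s n x - l x) \<le> e" if n: "n \<ge> N" and x: "x \<in> topspace X" for n x
      proof (rule LIMSEQ_le_const2)
        show "(\<lambda>m. cmod (s n x - s m x)) \<longlonglongrightarrow> cmod (s n x - l x)"
          by (intro tendsto_intros lim x)
        show "\<exists>M. \<forall>m\<ge>M. cmod (s n x - s m x) \<le> e"
          using N n x by (meson less_imp_le)
      qed
      then show ?thesis
        by blast
    qed
    have "continuous_map X Met_TC.mtopology l"
    proof (rule Met_TC.continuous_map_uniform_limit)
      show "\<forall>\<^sub>F n in sequentially. continuous_map X Met_TC.mtopology (s n)"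
        using s by simp
      show "\<forall>\<^sub>F n in sequentially. \<forall>x \<in> topspace X. l x \<in> UNIV \<and> dist (s n x) (l x) < e"
        if "e > 0" for e
      proof -
        obtain N where N: "\<forall>n\<ge>N. \<forall>x \<in> topspace X. cmod (s n x - l x) \<le> e / 2"
          using unif_lim[of "e / 2"] \<open>e > 0\<close> by auto
        have "dist (s n x) (l x) < e" if "n \<ge> N" "x \<in> topspace X" for n x
        proof -
          have "cmod (s n x - l x) \<le> e / 2"
            using N that by blast
          with \<open>e > 0\<close> show ?thesis
            unfolding dist_norm by linarith
        qed
        then show ?thesis
          unfolding eventually_sequentially by blast
      qed
    qed simp
    then have l: "l \<in> carrier ?A"
      by (simp add: l_def)
    have "(\<lambda>n. alg_norm ?A (s n \<ominus>\<^bsub>?A\<^esub> l)) \<longlonglongrightarrow> 0"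
    proof (rule LIMSEQ_I)
      fix r :: real assume "r > 0"
      then obtain N where N: "\<forall>n\<ge>N. \<forall>x \<in> topspace X. cmod (s n x - l x) \<le> r / 2"
        using unif_lim[of "r / 2"] by auto
      have "norm (alg_norm ?A (s n \<ominus>\<^bsub>?A\<^esub> l) - 0) < r" if "n \<ge> N" for n
      proof -
        have "alg_norm ?A (s n \<ominus>\<^bsub>?A\<^esub> l) \<le> r / 2"
          by (rule norm_le[OF minus_closed[OF s l]])
             (use N that \<open>r > 0\<close> cfun_algebra_minus[OF s l] in auto)
        with norm_ge(1)[OF minus_closed[OF s l, of n]] \<open>r > 0\<close> show ?thesis
          by simp
      qed
      then show "\<exists>N. \<forall>n\<ge>N. norm (alg_norm ?A (s n \<ominus>\<^bsub>?A\<^esub> l) - 0) < r"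
        by blast
    qed
    with l show "\<exists>l \<in> carrier ?A. (\<lambda>n. alg_norm ?A (s n \<ominus>\<^bsub>?A\<^esub> l)) \<longlonglongrightarrow> 0"
      by blast
  qed (use mult sm adj in
    \<open>auto simp: fun_eq_iff restrict_def extensional_def algebra_simps\<close>)
qed

end

theory Submission
  imports Defs
begin

text \<open>Self-adjoint elements of C(X) are the real-valued functions. Let \<open>D\<close> be a
  countable dense set and \<open>f\<close> real-valued. Since f(D) is countable, there are
  arbitrarily small reals t > 0 outside it, and f - t is then within t of f and has no zero on
  \<open>D\<close>; neither has its square. A continuous function annihilated by this square
  vanishes on \<open>D\<close>, hence everywhere (\<open>zero_on_dense_imp_zero\<close>), so the
  square is not a zero divisor (\<open>not_zero_divisor_cfun_algebra\<close>).\<close>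

lemma self_adjoint_cfun_algebra_iff:
  "self_adjoint (cfun_algebra X) f \<longleftrightarrow>
    f \<in> carrier (cfun_algebra X) \<and> (\<forall>x \<in> topspace X. f x \<in> \<real>)"
proof -
  have "(\<lambda>x \<in> topspace X. cnj (f x)) = f \<longleftrightarrow> (\<forall>x \<in> topspace X. f x \<in> \<real>)"
    if "f \<in> extensional (topspace X)"
  proof
    assume eq: "(\<lambda>x \<in> topspace X. cnj (f x)) = f"
    show "\<forall>x \<in> topspace X. f x \<in> \<real>"
      using fun_cong[OF eq] by (metis Reals_cnj_iff restrict_apply')
  next
    assume "\<forall>x \<in> topspace X. f x \<in> \<real>"
    then show "(\<lambda>x \<in> topspace X. cnj (f x)) = f"
      using that by (intro extensionalityI[of _ "topspace X"]) (auto simp: Reals_cnj_iff)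
  qed
  then show ?thesis
    by (auto simp: self_adjoint_def)
qed

text \<open>Points are closed in a T1 space, so the zero set of \<open>f\<close> is closed;
  containing a dense set, it is the whole space.\<close>

lemma zero_on_dense_imp_zero:
  fixes f :: "'x \<Rightarrow> 'b::{t1_space, zero}"
  assumes "continuous_map X euclidean f" "X closure_of D = topspace X"
    and "\<And>x. x \<in> D \<Longrightarrow> f x = 0" "x \<in> topspace X"
  shows "f x = 0"
proof -
  have "closedin X {x \<in> topspace X. f x \<in> {0}}"
    using assms(1) by (rule closedin_continuous_map_preimage) simp
  \<comment> \<open>\<open>D\<close> may have points outside the space; cutting them off leaves its
    closure unchanged.\<close>
  moreover have "D \<inter> topspace X \<subseteq> {x \<in> topspace X. f x \<in> {0}}"
    using assms(3) by auto
  ultimately have "X closure_of (D \<inter> topspace X) \<subseteq> {x \<in> topspace X. f x \<in> {0}}"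
    by (rule closure_of_minimal[rotated])
  then show ?thesis
    using assms(2,4) by (metis (no_types, lifting) closure_of_restrict inf_commute mem_Collect_eq
        singletonD subsetD)
qed

text \<open>Any continuous \<open>g\<close> with \<open>f * g = 0\<close> must vanish on
  \<open>D\<close>, where \<open>f\<close> can be cancelled, and so is zero by density.
  Commutativity covers the products in the other order.\<close>

lemma not_zero_divisor_cfun_algebra:
  assumes "X closure_of D = topspace X" "D \<subseteq> topspace X" "\<And>x. x \<in> D \<Longrightarrow> f x \<noteq> 0"
  shows "\<not> zero_divisor (cfun_algebra X) f"
proof -
  have "g = \<zero>\<^bsub>cfun_algebra X\<^esub>"
    if g: "g \<in> carrier (cfun_algebra X)"
      and eq: "(\<lambda>x \<in> topspace X. f x * g x) = (\<lambda>x \<in> topspace X. 0)" for g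
  proof -
    have "g x = 0" if "x \<in> D" for x
      using fun_cong[OF eq, of x] assms(2,3) that by auto
    then have "g x = 0" if "x \<in> topspace X" for x
      using zero_on_dense_imp_zero[of X g D x] g assms(1) that by simp
    with g show ?thesis
      by (intro extensionalityI[of _ "topspace X"]) auto
  qed
  then show ?thesis
    by (auto simp: zero_divisor_def mult.commute cong: restrict_cong)
qed

theorem proposition5:
  fixes X :: "'x topology"
  assumes "compact_space X" and "separable_space X"
  shows "ZDRR (cfun_algebra X) = 0"
proof -
  let ?A = "cfun_algebra X"
  interpret abelian_group ?A
    by (rule abelian_group_cfun_algebra)
  obtain D where D: "countable D" "D \<subseteq> topspace X" "X closure_of D = topspace X"
    using assms(2) by (auto simp: separable_space_def)
  have perturb: "\<exists>g. self_adjoint ?A g \<and> alg_norm ?A (f \<ominus>\<^bsub>?A\<^esub> g) < e \<and> \<not> zero_divisor ?A (g \<otimes>\<^bsub>?A\<^esub> g)"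
    if f: "self_adjoint ?A f" and e: "e > 0" for f e
  proof -
    \<comment> \<open>Only countably many shifts would create a zero on \<open>D\<close>, while the
      interval of admissible shifts is uncountable.\<close>
    have "uncountable ({0<..<e} - (\<lambda>x. Re (f x)) ` D)"
      using D(1) e by (intro uncountable_minus_countable) (auto simp: uncountable_open_interval)
    then obtain t where t: "0 < t" "t < e" "t \<notin> (\<lambda>x. Re (f x)) ` D"
      by (metis DiffE countable_empty equals0I greaterThanLessThan_iff)
    define g where "g = (\<lambda>x \<in> topspace X. f x - of_real t)"
    have fA: "f \<in> carrier ?A" and fr: "\<And>x. x \<in> topspace X \<Longrightarrow> f x \<in> \<real>"
      using f by (simp_all add: self_adjoint_cfun_algebra_iff)
    have gA: "g \<in> carrier ?A"
      using fA by (auto simp: g_def continuous_map_restrict_topspace intro!: continuous_map_diff)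
    then have g: "self_adjoint ?A g"
      using fr by (simp add: self_adjoint_cfun_algebra_iff g_def del: cfun_algebra_simps)
    \<comment> \<open>The difference of \<open>f\<close> and \<open>g\<close> is the constant
      \<open>t\<close>, and \<open>t < e\<close> turns this bound into the strict one.\<close>
    have "alg_norm ?A (f \<ominus>\<^bsub>?A\<^esub> g) \<le> t"
      unfolding cfun_norm_le_iff[OF assms(1) minus_closed[OF fA gA]]
      unfolding cfun_algebra_minus[OF fA gA]
      using t(1) by (simp add: g_def)
    moreover have "(g \<otimes>\<^bsub>?A\<^esub> g) x \<noteq> 0" if "x \<in> D" for x
    proof -
      \<comment> \<open>Equality would make \<open>t\<close> the real part of \<open>f x\<close>, a
        value that \<open>t\<close> was chosen to avoid.\<close>
      have "f x \<noteq> of_real t"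
        using t(3) that by force
      then show ?thesis
        using that D(2) by (auto simp: g_def)
    qed
    then have "\<not> zero_divisor ?A (g \<otimes>\<^bsub>?A\<^esub> g)"
      by (rule not_zero_divisor_cfun_algebra[OF D(3,2)])
    ultimately show ?thesis
      using g t(2) by (intro exI[of _ g]) auto
  qed
  have "ZDRR_le ?A 0"
    unfolding ZDRR_le_def
  proof (intro allI impI)
    fix a :: "nat \<Rightarrow> 'x \<Rightarrow> complex" and e :: real
    assume "\<forall>i \<in> {1..0 + 1}. self_adjoint ?A (a i)" and "e > 0"
    then obtain g where g: "self_adjoint ?A g" "alg_norm ?A (a 1 \<ominus>\<^bsub>?A\<^esub> g) < e"
        "\<not> zero_divisor ?A (g \<otimes>\<^bsub>?A\<^esub> g)"
      using perturb[of "a 1" e] by auto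
    \<comment> \<open>For rank 0 the index set is a singleton, so the sum collapses to one square
      once that square is known to lie in the carrier.\<close>
    have "g \<otimes>\<^bsub>?A\<^esub> g \<in> carrier ?A"
      using g(1) by (auto simp: self_adjoint_def continuous_map_restrict_topspace
          intro!: continuous_map_complex_mult)
    then have "(\<Oplus>\<^bsub>?A\<^esub>i \<in> {1..0 + 1::nat}. g \<otimes>\<^bsub>?A\<^esub> g) = g \<otimes>\<^bsub>?A\<^esub> g"
      by (simp del: cfun_algebra_simps)
    with g show "\<exists>b. (\<forall>i \<in> {1..0 + 1}. self_adjoint ?A (b i) \<and> alg_norm ?A (a i \<ominus>\<^bsub>?A\<^esub> b i) < e) \<and>
        \<not> zero_divisor ?A (\<Oplus>\<^bsub>?A\<^esub>i \<in> {1..0 + 1}. b i \<otimes>\<^bsub>?A\<^esub> b i)"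
      by (intro exI[of _ "\<lambda>_. g"]) (simp del: cfun_algebra_simps)
  qed
  \<comment> \<open>The infimum lies in \<open>enat\<close>, whose least element is 0, so this upper
    bound decides its value.\<close>
  then have "ZDRR ?A \<le> enat 0"
    unfolding ZDRR_def by (intro INF_lower) simp
  then show ?thesis
    by (simp add: zero_enat_def[symmetric])
qed

end
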